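(* Let $R$ and $S$ be 2-torsion free rings with identity, and let $M$ be a unitary $(R,S)$-bimodule which is faithful as a left $R$-module and faithful as a right $S$-module. Then every Jordan superderivation of the upper triangular matrix ring $T=\begin{pmatrix}R&M\\0&S\end{pmatrix}$ is a derivation of $T$.
   Context: All rings are unital. A derivation of a ring $A$ is an additive map $d:A\to A$ with $d(ab)=d(a)b+ad(b)$ for all $a,b\in A$. A superring is a ring $A$ with identity with additive subgroups $A_0,A_1$ such that $A=A_0\oplus A_1$ and $A_iA_j\subseteq A_{i+j}$ (indices modulo 2). For $a\in A_i$ write $|a|=i$. For $x,y\in A_0\cup A_1$ the Jordan superproduct is $x\circ_s y=xy+(-1)^{|x||y|}yx$. For $i\in\{0,1\}$, a Jordan superderivation of degree $i$ of $A$ is an additive map $d_i:A\to A$ with $d_i(A_j)\subseteq A_{i+j}$ (indices modulo 2) and $d_i(x\circ_s y)=d_i(x)\circ_s y+(-1)^{i|x|}x\circ_s d_i(y)$ for all $x,y\in A_0\cup A_1$. A Jordan superderivation of $A$ is the sum of a Jordan superderivation of degree $0$ and one of degree $1$. $T$ consists of the matrices $\begin{pmatrix}r&m\\0&s\end{pmatrix}$ ($r\in R$, $m\in M$, $s\in S$) with the usual matrix operations. It is a superring whose even part $T_0$ is the set of diagonal matrices $\begin{pmatrix}r&0\\0&s\end{pmatrix}$ and whose odd part $T_1$ is the set of matrices $\begin{pmatrix}0&m\\0&0\end{pmatrix}$. *)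

theory Defs
  imports "HOL-Algebra.Algebra" "HOL-Library.Z2"
begin

section \<open>Derivations and Jordan superderivations\<close>

definition two_torsion_free :: "('a, 'b) ring_scheme \<Rightarrow> bool" where
  "two_torsion_free A \<longleftrightarrow>
    (\<forall>x\<in>carrier A. x \<oplus>\<^bsub>A\<^esub> x = \<zero>\<^bsub>A\<^esub> \<longrightarrow> x = \<zero>\<^bsub>A\<^esub>)"

definition derivation :: "('a, 'b) ring_scheme \<Rightarrow> ('a \<Rightarrow> 'a) \<Rightarrow> bool" where
  "derivation A d \<longleftrightarrow>
    d \<in> hom (add_monoid A) (add_monoid A) \<and>
    (\<forall>a\<in>carrier A. \<forall>b\<in>carrier A.
       d (a \<otimes>\<^bsub>A\<^esub> b) = (d a \<otimes>\<^bsub>A\<^esub> b) \<oplus>\<^bsub>A\<^esub> (a \<otimes>\<^bsub>A\<^esub> d b))"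

text \<open>
  The index type \<^typ>\<open>bit\<close> is the two-element field, so sums and products of degrees are
  automatically taken modulo 2.
\<close>

locale superring = ring A for A (structure) +
  fixes G :: "bit \<Rightarrow> 'a set"
  assumes homogeneous_subgroup: "additive_subgroup (G i) A"
    and carrier_sum: "carrier A = G 0 <+> G 1"
    and inter_zero: "G 0 \<inter> G 1 = {\<zero>}"
    and graded_mult: "\<lbrakk>x \<in> G i; y \<in> G j\<rbrakk> \<Longrightarrow> x \<otimes> y \<in> G (i + j)"

text \<open>\<open>super_sign A i x\<close> is \<open>(-1)\<^sup>i x\<close>.\<close>

definition super_sign :: "('a, 'b) ring_scheme \<Rightarrow> bit \<Rightarrow> 'a \<Rightarrow> 'a" where
  "super_sign A i x = (if i = 0 then x else \<ominus>\<^bsub>A\<^esub> x)"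

text \<open>
  The Jordan superproduct of \<open>x\<close> of degree \<open>i\<close> and \<open>y\<close> of degree \<open>j\<close>. The degrees are explicit
  arguments, since zero has both degrees; for \<open>x = 0\<close> or \<open>y = 0\<close> the product is zero whichever
  degrees are chosen.
\<close>

definition jordan_superproduct ::
    "('a, 'b) ring_scheme \<Rightarrow> bit \<Rightarrow> bit \<Rightarrow> 'a \<Rightarrow> 'a \<Rightarrow> 'a" where
  "jordan_superproduct A i j x y =
    (x \<otimes>\<^bsub>A\<^esub> y) \<oplus>\<^bsub>A\<^esub> super_sign A (i * j) (y \<otimes>\<^bsub>A\<^esub> x)"

definition jordan_superderivation_deg ::
    "('a, 'b) ring_scheme \<Rightarrow> (bit \<Rightarrow> 'a set) \<Rightarrow> bit \<Rightarrow> ('a \<Rightarrow> 'a) \<Rightarrow> bool" where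
  "jordan_superderivation_deg A G k d \<longleftrightarrow>
    d \<in> hom (add_monoid A) (add_monoid A) \<and>
    (\<forall>j. d ` G j \<subseteq> G (k + j)) \<and>
    (\<forall>i j. \<forall>x\<in>G i. \<forall>y\<in>G j.
       d (jordan_superproduct A i j x y) =
         jordan_superproduct A (k + i) j (d x) y \<oplus>\<^bsub>A\<^esub>
         super_sign A (k * i) (jordan_superproduct A i (k + j) x (d y)))"

definition jordan_superderivation ::
    "('a, 'b) ring_scheme \<Rightarrow> (bit \<Rightarrow> 'a set) \<Rightarrow> ('a \<Rightarrow> 'a) \<Rightarrow> bool" where
  "jordan_superderivation A G d \<longleftrightarrow>
    (\<exists>d0 d1. jordan_superderivation_deg A G 0 d0 \<and> jordan_superderivation_deg A G 1 d1 \<and>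
       (\<forall>x\<in>carrier A. d x = d0 x \<oplus>\<^bsub>A\<^esub> d1 x))"


section \<open>Bimodules\<close>

text \<open>
  The library locale \<^locale>\<open>module\<close> is restricted to commutative rings, so only its record type is
  reused, extended by a right scalar multiplication. As for \<^locale>\<open>module\<close>, the ring
  multiplication and unit fields of the record are irrelevant.
\<close>

record ('r, 's, 'm) bimodule = "('r, 'm) module" +
  rsmult :: "'m \<Rightarrow> 's \<Rightarrow> 'm" (infixl \<open>\<odot>\<^sub>r\<index>\<close> 70)

locale unitary_bimodule = R: ring R + S: ring S + M: abelian_group M
  for R :: "('r, 'a) ring_scheme" and S :: "('s, 'b) ring_scheme"
    and M :: "('r, 's, 'm, 'c) bimodule_scheme" (structure) +
  assumes smult_closed: "\<lbrakk>r \<in> carrier R; m \<in> carrier M\<rbrakk> \<Longrightarrow> r \<odot> m \<in> carrier M"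
    and smult_l_distr: "\<lbrakk>r \<in> carrier R; r' \<in> carrier R; m \<in> carrier M\<rbrakk> \<Longrightarrow>
      (r \<oplus>\<^bsub>R\<^esub> r') \<odot> m = (r \<odot> m) \<oplus> (r' \<odot> m)"
    and smult_r_distr: "\<lbrakk>r \<in> carrier R; m \<in> carrier M; m' \<in> carrier M\<rbrakk> \<Longrightarrow>
      r \<odot> (m \<oplus> m') = (r \<odot> m) \<oplus> (r \<odot> m')"
    and smult_assoc: "\<lbrakk>r \<in> carrier R; r' \<in> carrier R; m \<in> carrier M\<rbrakk> \<Longrightarrow>
      (r \<otimes>\<^bsub>R\<^esub> r') \<odot> m = r \<odot> (r' \<odot> m)"
    and smult_one: "m \<in> carrier M \<Longrightarrow> \<one>\<^bsub>R\<^esub> \<odot> m = m"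
    and rsmult_closed: "\<lbrakk>m \<in> carrier M; s \<in> carrier S\<rbrakk> \<Longrightarrow> m \<odot>\<^sub>r s \<in> carrier M"
    and rsmult_l_distr: "\<lbrakk>m \<in> carrier M; m' \<in> carrier M; s \<in> carrier S\<rbrakk> \<Longrightarrow>
      (m \<oplus> m') \<odot>\<^sub>r s = (m \<odot>\<^sub>r s) \<oplus> (m' \<odot>\<^sub>r s)"
    and rsmult_r_distr: "\<lbrakk>m \<in> carrier M; s \<in> carrier S; s' \<in> carrier S\<rbrakk> \<Longrightarrow>
      m \<odot>\<^sub>r (s \<oplus>\<^bsub>S\<^esub> s') = (m \<odot>\<^sub>r s) \<oplus> (m \<odot>\<^sub>r s')"
    and rsmult_assoc: "\<lbrakk>m \<in> carrier M; s \<in> carrier S; s' \<in> carrier S\<rbrakk> \<Longrightarrow>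
      m \<odot>\<^sub>r (s \<otimes>\<^bsub>S\<^esub> s') = (m \<odot>\<^sub>r s) \<odot>\<^sub>r s'"
    and rsmult_one: "m \<in> carrier M \<Longrightarrow> m \<odot>\<^sub>r \<one>\<^bsub>S\<^esub> = m"
    and smult_rsmult: "\<lbrakk>r \<in> carrier R; m \<in> carrier M; s \<in> carrier S\<rbrakk> \<Longrightarrow>
      (r \<odot> m) \<odot>\<^sub>r s = r \<odot> (m \<odot>\<^sub>r s)"

definition faithful_left ::
    "('r, 'a) ring_scheme \<Rightarrow> ('r, 's, 'm, 'c) bimodule_scheme \<Rightarrow> bool" where
  "faithful_left R M \<longleftrightarrow>
    (\<forall>r\<in>carrier R. (\<forall>m\<in>carrier M. r \<odot>\<^bsub>M\<^esub> m = \<zero>\<^bsub>M\<^esub>) \<longrightarrow> r = \<zero>\<^bsub>R\<^esub>)"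

definition faithful_right ::
    "('s, 'b) ring_scheme \<Rightarrow> ('r, 's, 'm, 'c) bimodule_scheme \<Rightarrow> bool" where
  "faithful_right S M \<longleftrightarrow>
    (\<forall>s\<in>carrier S. (\<forall>m\<in>carrier M. m \<odot>\<^sub>r\<^bsub>M\<^esub> s = \<zero>\<^bsub>M\<^esub>) \<longrightarrow> s = \<zero>\<^bsub>S\<^esub>)"


section \<open>Upper triangular matrix rings\<close>

text \<open>The triple \<open>(r, m, s)\<close> stands for the matrix with rows \<open>(r, m)\<close> and \<open>(0, s)\<close>.\<close>

definition triangular_ring ::
    "('r, 'a) ring_scheme \<Rightarrow> ('r, 's, 'm, 'c) bimodule_scheme \<Rightarrow> ('s, 'b) ring_scheme \<Rightarrow>
     ('r \<times> 'm \<times> 's) ring" where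
  "triangular_ring R M S =
    \<lparr>carrier = carrier R \<times> carrier M \<times> carrier S,
     monoid.mult = (\<lambda>(r, m, s) (r', m', s').
       (r \<otimes>\<^bsub>R\<^esub> r', (r \<odot>\<^bsub>M\<^esub> m') \<oplus>\<^bsub>M\<^esub> (m \<odot>\<^sub>r\<^bsub>M\<^esub> s'), s \<otimes>\<^bsub>S\<^esub> s')),
     one = (\<one>\<^bsub>R\<^esub>, \<zero>\<^bsub>M\<^esub>, \<one>\<^bsub>S\<^esub>),
     ring.zero = (\<zero>\<^bsub>R\<^esub>, \<zero>\<^bsub>M\<^esub>, \<zero>\<^bsub>S\<^esub>),
     add = (\<lambda>(r, m, s) (r', m', s'). (r \<oplus>\<^bsub>R\<^esub> r', m \<oplus>\<^bsub>M\<^esub> m', s \<oplus>\<^bsub>S\<^esub> s'))\<rparr>"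

definition triangular_grading ::
    "('r, 'a) ring_scheme \<Rightarrow> ('r, 's, 'm, 'c) bimodule_scheme \<Rightarrow> ('s, 'b) ring_scheme \<Rightarrow>
     bit \<Rightarrow> ('r \<times> 'm \<times> 's) set" where
  "triangular_grading R M S i =
    (if i = 0 then carrier R \<times> {\<zero>\<^bsub>M\<^esub>} \<times> carrier S
     else {\<zero>\<^bsub>R\<^esub>} \<times> carrier M \<times> {\<zero>\<^bsub>S\<^esub>})"

context unitary_bimodule
begin

lemma smult_zero: "r \<in> carrier R \<Longrightarrow> r \<odot> \<zero> = \<zero>"
  by (metis M.add.l_cancel_one M.zero_closed M.l_zero smult_closed smult_r_distr)

lemma zero_smult: "m \<in> carrier M \<Longrightarrow> \<zero>\<^bsub>R\<^esub> \<odot> m = \<zero>"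
  by (metis M.add.l_cancel_one R.zero_closed R.l_zero smult_closed smult_l_distr)

lemma zero_rsmult: "s \<in> carrier S \<Longrightarrow> \<zero> \<odot>\<^sub>r s = \<zero>"
  by (metis M.add.l_cancel_one M.zero_closed M.l_zero rsmult_closed rsmult_l_distr)

lemma rsmult_zero: "m \<in> carrier M \<Longrightarrow> m \<odot>\<^sub>r \<zero>\<^bsub>S\<^esub> = \<zero>"
  by (metis M.add.l_cancel_one S.zero_closed S.l_zero rsmult_closed rsmult_r_distr)

lemmas bimodule_simps =
  smult_closed smult_l_distr smult_r_distr smult_assoc smult_one
  rsmult_closed rsmult_l_distr rsmult_r_distr rsmult_assoc rsmult_one smult_rsmult
  smult_zero zero_smult zero_rsmult rsmult_zero

lemma triangular_ring_is_ring: "ring (triangular_ring R M S)"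
proof (rule ringI)
  show "abelian_group (triangular_ring R M S)"
  proof (rule abelian_groupI)
    fix x assume x: "x \<in> carrier (triangular_ring R M S)"
    obtain r m s where "x = (r, m, s)" by (cases x)
    with x show "\<exists>y\<in>carrier (triangular_ring R M S).
        y \<oplus>\<^bsub>triangular_ring R M S\<^esub> x = \<zero>\<^bsub>triangular_ring R M S\<^esub>"
      by (intro bexI[of _ "(\<ominus>\<^bsub>R\<^esub> r, \<ominus> m, \<ominus>\<^bsub>S\<^esub> s)"])
        (auto simp: triangular_ring_def R.l_neg M.l_neg S.l_neg)
  qed (auto simp: triangular_ring_def R.a_ac M.a_ac S.a_ac)
  show "monoid (triangular_ring R M S)"
    by (rule monoidI)
      (auto simp: triangular_ring_def bimodule_simps R.m_assoc S.m_assoc M.a_assoc)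
qed (auto simp: triangular_ring_def bimodule_simps R.l_distr S.l_distr R.r_distr S.r_distr M.a_ac)

lemma superring_triangular: "superring (triangular_ring R M S) (triangular_grading R M S)"
proof -
  interpret T: ring "triangular_ring R M S" by (rule triangular_ring_is_ring)
  have neg: "\<ominus>\<^bsub>triangular_ring R M S\<^esub> (r, m, s) = (\<ominus>\<^bsub>R\<^esub> r, \<ominus> m, \<ominus>\<^bsub>S\<^esub> s)"
    if "r \<in> carrier R" "m \<in> carrier M" "s \<in> carrier S" for r m s
    by (rule T.minus_equality) (use that in \<open>auto simp: triangular_ring_def R.l_neg M.l_neg S.l_neg\<close>)
  show ?thesis
  proof (rule superring.intro[OF T.ring_axioms superring_axioms.intro])
    fix i
    show "additive_subgroup (triangular_grading R M S i) (triangular_ring R M S)"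
    proof (intro additive_subgroup.intro T.add.subgroupI)
      fix a assume a: "a \<in> triangular_grading R M S i"
      then show "\<ominus>\<^bsub>triangular_ring R M S\<^esub> a \<in> triangular_grading R M S i"
        by (auto simp: triangular_grading_def neg split: if_splits)
    qed (auto simp: triangular_ring_def triangular_grading_def split: if_splits)
  next
    show "carrier (triangular_ring R M S) =
        triangular_grading R M S 0 <+>\<^bsub>triangular_ring R M S\<^esub> triangular_grading R M S 1"
      by (force simp: set_add_def' triangular_ring_def triangular_grading_def)
  next
    show "triangular_grading R M S 0 \<inter> triangular_grading R M S 1 =
        {\<zero>\<^bsub>triangular_ring R M S\<^esub>}"
      by (auto simp: triangular_ring_def triangular_grading_def)
  next
    fix x y i j
    assume "x \<in> triangular_grading R M S i" "y \<in> triangular_grading R M S j"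
    then show "x \<otimes>\<^bsub>triangular_ring R M S\<^esub> y \<in> triangular_grading R M S (i + j)"
      by (cases i; cases j)
        (auto simp: triangular_ring_def triangular_grading_def bimodule_simps)
  qed
qed

end

end

theory Submission
  imports Defs
begin

text \<open>
  Let \<open>e = (1, 0, 0)\<close> and \<open>e' = (0, 0, 1)\<close> be the two diagonal idempotents of \<open>T\<close>. Everything
  follows by feeding \<open>e\<close> and \<open>e'\<close> to the Jordan identity.

  A superderivation of degree 0 kills both idempotents: applied to \<open>e \<circ> e = 2e\<close> the identity gives
  \<open>2 d(e) = 2 (e d(e) + d(e) e)\<close>, where 2 can be cancelled because \<open>d(e)\<close> is diagonal. Then
  \<open>e \<circ> x = 2x\<close> for \<open>x\<close> in the \<open>R\<close>-corner shows that \<open>d\<close> preserves this corner, and likewise the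
  \<open>S\<close>-corner. So \<open>d\<close> acts blockwise by additive maps \<open>f\<close>, \<open>h\<close>, \<open>g\<close>, and the identity on an even
  and an odd element reads \<open>h(r m) = f(r) m + r h(m)\<close> and \<open>h(m s) = h(m) s + m g(s)\<close>. Comparing the
  two expansions of \<open>h((r r') m) = h(r (r' m))\<close> shows that \<open>f(r r') - f(r) r' - r f(r')\<close> annihilates
  \<open>M\<close>, so \<open>f\<close> is a derivation by faithfulness; symmetrically for \<open>g\<close>
  (\<open>blockwise_derivation\<close>, \<open>degree_zero_is_derivation\<close>).

  A superderivation of degree 1 is inner. It kills the odd part, because for odd \<open>x\<close> the identity
  for \<open>e \<circ> x = x\<close> and for \<open>e' \<circ> x = x\<close> becomes \<open>d(x) = e \<circ> d(x)\<close> and \<open>d(x) = e' \<circ> d(x)\<close>, of which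
  the first leaves no \<open>S\<close>-entry and the second no \<open>R\<close>-entry. On the diagonal, \<open>e \<circ> e' = 0\<close>
  together with \<open>e \<circ> x = 2x\<close> on the \<open>R\<close>-corner and \<open>e' \<circ> x = 2x\<close> on the \<open>S\<close>-corner force
  \<open>d(r, 0, s) = (0, r a - a s, 0)\<close> with \<open>d(e) = (0, a, 0)\<close>, that is \<open>d(x) = x d(e) - d(e) x\<close> (\<open>degree_one_is_inner\<close>).

  The cancellation of 2 is only ever performed in \<open>R\<close> and \<open>S\<close>; in \<open>M\<close>, which may have 2-torsion,
  only ordinary additive cancellation occurs.
\<close>

section \<open>Sums of derivations and inner derivations\<close>

lemma derivation_add:
  assumes "ring A" and d0: "derivation A d0" and d1: "derivation A d1"
    and d: "\<And>x. x \<in> carrier A \<Longrightarrow> d x = d0 x \<oplus>\<^bsub>A\<^esub> d1 x"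
  shows "derivation A d"
proof -
  interpret ring A by fact
  have cl: "d0 x \<in> carrier A" "d1 x \<in> carrier A" if "x \<in> carrier A" for x
    using that d0 d1 by (auto simp: derivation_def hom_def)
  have add: "d0 (x \<oplus>\<^bsub>A\<^esub> y) = d0 x \<oplus>\<^bsub>A\<^esub> d0 y" "d1 (x \<oplus>\<^bsub>A\<^esub> y) = d1 x \<oplus>\<^bsub>A\<^esub> d1 y"
    if "x \<in> carrier A" "y \<in> carrier A" for x y
    using that d0 d1 by (auto simp: derivation_def hom_def)
  have prod: "d0 (x \<otimes>\<^bsub>A\<^esub> y) = d0 x \<otimes>\<^bsub>A\<^esub> y \<oplus>\<^bsub>A\<^esub> x \<otimes>\<^bsub>A\<^esub> d0 y"
      "d1 (x \<otimes>\<^bsub>A\<^esub> y) = d1 x \<otimes>\<^bsub>A\<^esub> y \<oplus>\<^bsub>A\<^esub> x \<otimes>\<^bsub>A\<^esub> d1 y"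
    if "x \<in> carrier A" "y \<in> carrier A" for x y
    using that d0 d1 by (auto simp: derivation_def)
  show ?thesis
    by (auto simp: derivation_def hom_def d cl add prod l_distr r_distr a_ac)
qed

lemma derivation_inner:
  assumes "ring A" and a: "a \<in> carrier A"
    and d: "\<And>x. x \<in> carrier A \<Longrightarrow> d x = x \<otimes>\<^bsub>A\<^esub> a \<ominus>\<^bsub>A\<^esub> a \<otimes>\<^bsub>A\<^esub> x"
  shows "derivation A d"
proof -
  interpret ring A by fact
  have cancel: "p \<oplus>\<^bsub>A\<^esub> \<ominus>\<^bsub>A\<^esub> q = (u \<oplus>\<^bsub>A\<^esub> \<ominus>\<^bsub>A\<^esub> q) \<oplus>\<^bsub>A\<^esub> (p \<oplus>\<^bsub>A\<^esub> \<ominus>\<^bsub>A\<^esub> u)"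
    if "p \<in> carrier A" "q \<in> carrier A" "u \<in> carrier A" for p q u
  proof -
    have "(u \<oplus>\<^bsub>A\<^esub> \<ominus>\<^bsub>A\<^esub> q) \<oplus>\<^bsub>A\<^esub> (p \<oplus>\<^bsub>A\<^esub> \<ominus>\<^bsub>A\<^esub> u) = (p \<oplus>\<^bsub>A\<^esub> \<ominus>\<^bsub>A\<^esub> u) \<oplus>\<^bsub>A\<^esub> (u \<oplus>\<^bsub>A\<^esub> \<ominus>\<^bsub>A\<^esub> q)"
      using that by (intro a_comm) auto
    also have "\<dots> = p \<oplus>\<^bsub>A\<^esub> \<ominus>\<^bsub>A\<^esub> q"
      using that by (simp add: a_assoc r_neg1)
    finally show ?thesis by simp
  qed
  have "d (x \<otimes>\<^bsub>A\<^esub> y) = d x \<otimes>\<^bsub>A\<^esub> y \<oplus>\<^bsub>A\<^esub> x \<otimes>\<^bsub>A\<^esub> d y"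
    if "x \<in> carrier A" "y \<in> carrier A" for x y
    using that a cancel[of "x \<otimes>\<^bsub>A\<^esub> (y \<otimes>\<^bsub>A\<^esub> a)" "a \<otimes>\<^bsub>A\<^esub> (x \<otimes>\<^bsub>A\<^esub> y)" "x \<otimes>\<^bsub>A\<^esub> (a \<otimes>\<^bsub>A\<^esub> y)"]
    by (simp add: d minus_eq l_distr r_distr l_minus r_minus m_assoc)
  moreover have "d (x \<oplus>\<^bsub>A\<^esub> y) = d x \<oplus>\<^bsub>A\<^esub> d y" if "x \<in> carrier A" "y \<in> carrier A" for x y
    using that a by (simp add: d minus_eq l_distr r_distr minus_add a_ac)
  ultimately show ?thesis
    using a by (auto simp: derivation_def hom_def d)
qed

lemma two_torsion_freeD:
  "\<lbrakk>two_torsion_free A; x \<in> carrier A; x \<oplus>\<^bsub>A\<^esub> x = \<zero>\<^bsub>A\<^esub>\<rbrakk> \<Longrightarrow> x = \<zero>\<^bsub>A\<^esub>"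
  by (simp add: two_torsion_free_def)

text \<open>
  The hypothesis is the shape that \<open>d(e \<circ> e) = d(e) \<circ> e + e \<circ> d(e)\<close> takes in the corner of an
  idempotent \<open>e\<close>, where \<open>e\<close> acts as the identity.
\<close>

lemma (in ring) two_torsion_free_cancel:
  assumes "two_torsion_free R" "x \<in> carrier R" "x \<oplus> x = (x \<oplus> x) \<oplus> (x \<oplus> x)"
  shows "x = \<zero>"
proof (rule two_torsion_freeD[OF assms(1,2)])
  show "x \<oplus> x = \<zero>"
    using assms(2,3) by (metis add.l_cancel_one' add.m_closed)
qed

section \<open>Computation in the triangular ring\<close>

context unitary_bimodule
begin

abbreviation T where "T \<equiv> triangular_ring R M S"
abbreviation G where "G \<equiv> triangular_grading R M S"

lemma triangular_simps:
  "(r, m, s) \<in> carrier T \<longleftrightarrow> r \<in> carrier R \<and> m \<in> carrier M \<and> s \<in> carrier S"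
  "(r, m, s) \<oplus>\<^bsub>T\<^esub> (r', m', s') = (r \<oplus>\<^bsub>R\<^esub> r', m \<oplus> m', s \<oplus>\<^bsub>S\<^esub> s')"
  "(r, m, s) \<otimes>\<^bsub>T\<^esub> (r', m', s') = (r \<otimes>\<^bsub>R\<^esub> r', (r \<odot> m') \<oplus> (m \<odot>\<^sub>r s'), s \<otimes>\<^bsub>S\<^esub> s')"
  "\<zero>\<^bsub>T\<^esub> = (\<zero>\<^bsub>R\<^esub>, \<zero>, \<zero>\<^bsub>S\<^esub>)"
  by (auto simp: triangular_ring_def)

lemma grading_simps:
  "(r, m, s) \<in> G 0 \<longleftrightarrow> r \<in> carrier R \<and> m = \<zero> \<and> s \<in> carrier S"
  "(r, m, s) \<in> G 1 \<longleftrightarrow> r = \<zero>\<^bsub>R\<^esub> \<and> m \<in> carrier M \<and> s = \<zero>\<^bsub>S\<^esub>"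
  by (auto simp: triangular_grading_def)

lemma triangular_minus:
  assumes "r \<in> carrier R" "m \<in> carrier M" "s \<in> carrier S"
  shows "\<ominus>\<^bsub>T\<^esub> (r, m, s) = (\<ominus>\<^bsub>R\<^esub> r, \<ominus> m, \<ominus>\<^bsub>S\<^esub> s)"
proof -
  interpret T: ring T by (rule triangular_ring_is_ring)
  show ?thesis
    by (rule T.minus_equality) (use assms in \<open>auto simp: triangular_simps R.l_neg M.l_neg S.l_neg\<close>)
qed

lemma superproduct_even_even:
  assumes "r \<in> carrier R" "r' \<in> carrier R" "s \<in> carrier S" "s' \<in> carrier S"
  shows "jordan_superproduct T 0 0 (r, \<zero>, s) (r', \<zero>, s') =
    ((r \<otimes>\<^bsub>R\<^esub> r') \<oplus>\<^bsub>R\<^esub> (r' \<otimes>\<^bsub>R\<^esub> r), \<zero>, (s \<otimes>\<^bsub>S\<^esub> s') \<oplus>\<^bsub>S\<^esub> (s' \<otimes>\<^bsub>S\<^esub> s))"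
  using assms by (simp add: jordan_superproduct_def super_sign_def triangular_simps bimodule_simps)

lemma superproduct_even_odd:
  assumes "r \<in> carrier R" "s \<in> carrier S" "m \<in> carrier M"
  shows "jordan_superproduct T 0 1 (r, \<zero>, s) (\<zero>\<^bsub>R\<^esub>, m, \<zero>\<^bsub>S\<^esub>) =
    (\<zero>\<^bsub>R\<^esub>, (r \<odot> m) \<oplus> (m \<odot>\<^sub>r s), \<zero>\<^bsub>S\<^esub>)"
  using assms by (simp add: jordan_superproduct_def super_sign_def triangular_simps bimodule_simps)

lemma superproduct_odd_even:
  assumes "r \<in> carrier R" "s \<in> carrier S" "m \<in> carrier M"
  shows "jordan_superproduct T 1 0 (\<zero>\<^bsub>R\<^esub>, m, \<zero>\<^bsub>S\<^esub>) (r, \<zero>, s) =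
    (\<zero>\<^bsub>R\<^esub>, (r \<odot> m) \<oplus> (m \<odot>\<^sub>r s), \<zero>\<^bsub>S\<^esub>)"
  using assms
  by (simp add: jordan_superproduct_def super_sign_def triangular_simps bimodule_simps M.a_comm)

lemma superproduct_odd_odd:
  assumes "m \<in> carrier M" "m' \<in> carrier M"
  shows "jordan_superproduct T 1 1 (\<zero>\<^bsub>R\<^esub>, m, \<zero>\<^bsub>S\<^esub>) (\<zero>\<^bsub>R\<^esub>, m', \<zero>\<^bsub>S\<^esub>) = (\<zero>\<^bsub>R\<^esub>, \<zero>, \<zero>\<^bsub>S\<^esub>)"
  using assms
  by (simp add: jordan_superproduct_def super_sign_def triangular_simps bimodule_simps triangular_minus)

lemma triangular_decomposition:
  assumes "d \<in> hom (add_monoid T) (add_monoid T)"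
    and "r \<in> carrier R" "m \<in> carrier M" "s \<in> carrier S"
  shows "d (r, m, s) = d (r, \<zero>, \<zero>\<^bsub>S\<^esub>) \<oplus>\<^bsub>T\<^esub> (d (\<zero>\<^bsub>R\<^esub>, m, \<zero>\<^bsub>S\<^esub>) \<oplus>\<^bsub>T\<^esub> d (\<zero>\<^bsub>R\<^esub>, \<zero>, s))"
proof -
  have add: "d (x \<oplus>\<^bsub>T\<^esub> y) = d x \<oplus>\<^bsub>T\<^esub> d y" if "x \<in> carrier T" "y \<in> carrier T" for x y
    using assms(1) that by (simp add: hom_def)
  have "d (r, m, s) = d ((r, \<zero>, \<zero>\<^bsub>S\<^esub>) \<oplus>\<^bsub>T\<^esub> ((\<zero>\<^bsub>R\<^esub>, m, \<zero>\<^bsub>S\<^esub>) \<oplus>\<^bsub>T\<^esub> (\<zero>\<^bsub>R\<^esub>, \<zero>, s)))"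
    using assms(2-) by (simp add: triangular_simps)
  also have "\<dots> = d (r, \<zero>, \<zero>\<^bsub>S\<^esub>) \<oplus>\<^bsub>T\<^esub> d ((\<zero>\<^bsub>R\<^esub>, m, \<zero>\<^bsub>S\<^esub>) \<oplus>\<^bsub>T\<^esub> (\<zero>\<^bsub>R\<^esub>, \<zero>, s))"
    using assms(2-) by (intro add) (auto simp: triangular_simps)
  also have "d ((\<zero>\<^bsub>R\<^esub>, m, \<zero>\<^bsub>S\<^esub>) \<oplus>\<^bsub>T\<^esub> (\<zero>\<^bsub>R\<^esub>, \<zero>, s)) = d (\<zero>\<^bsub>R\<^esub>, m, \<zero>\<^bsub>S\<^esub>) \<oplus>\<^bsub>T\<^esub> d (\<zero>\<^bsub>R\<^esub>, \<zero>, s)"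
    using assms(2-) by (intro add) (auto simp: triangular_simps)
  finally show ?thesis .
qed

lemma additive_zero:
  assumes "d \<in> hom (add_monoid T) (add_monoid T)"
  shows "d (\<zero>\<^bsub>R\<^esub>, \<zero>, \<zero>\<^bsub>S\<^esub>) = (\<zero>\<^bsub>R\<^esub>, \<zero>, \<zero>\<^bsub>S\<^esub>)"
proof -
  interpret T: ring T by (rule triangular_ring_is_ring)
  show ?thesis
    using hom_one[OF assms T.a_group T.a_group] by (simp add: triangular_simps)
qed

section \<open>Superderivations of degree 0\<close>

text \<open>
  Faithfulness turns the compatibility of \<open>f\<close> and \<open>g\<close> with \<open>h\<close> into the product rule for \<open>f\<close> and
  \<open>g\<close>, by associativity of the two actions.
\<close>

lemma blockwise_derivation:
  assumes "faithful_left R M" "faithful_right S M"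
    and additive: "d \<in> hom (add_monoid T) (add_monoid T)"
    and f: "\<And>r. r \<in> carrier R \<Longrightarrow> f r \<in> carrier R"
    and h: "\<And>m. m \<in> carrier M \<Longrightarrow> h m \<in> carrier M"
    and g: "\<And>s. s \<in> carrier S \<Longrightarrow> g s \<in> carrier S"
    and d: "\<And>r m s. \<lbrakk>r \<in> carrier R; m \<in> carrier M; s \<in> carrier S\<rbrakk> \<Longrightarrow>
      d (r, m, s) = (f r, h m, g s)"
    and left: "\<And>r m. \<lbrakk>r \<in> carrier R; m \<in> carrier M\<rbrakk> \<Longrightarrow> h (r \<odot> m) = (f r \<odot> m) \<oplus> (r \<odot> h m)"
    and right: "\<And>m s. \<lbrakk>m \<in> carrier M; s \<in> carrier S\<rbrakk> \<Longrightarrow>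
      h (m \<odot>\<^sub>r s) = (m \<odot>\<^sub>r g s) \<oplus> (h m \<odot>\<^sub>r s)"
  shows "derivation T d"
proof -
  have h_add: "h (m \<oplus> m') = h m \<oplus> h m'" if "m \<in> carrier M" "m' \<in> carrier M" for m m'
  proof -
    have "d ((\<zero>\<^bsub>R\<^esub>, m, \<zero>\<^bsub>S\<^esub>) \<oplus>\<^bsub>T\<^esub> (\<zero>\<^bsub>R\<^esub>, m', \<zero>\<^bsub>S\<^esub>)) = d (\<zero>\<^bsub>R\<^esub>, m, \<zero>\<^bsub>S\<^esub>) \<oplus>\<^bsub>T\<^esub> d (\<zero>\<^bsub>R\<^esub>, m', \<zero>\<^bsub>S\<^esub>)"
      using additive that by (simp add: hom_def triangular_simps(1))
    then show ?thesis using that by (simp add: triangular_simps d)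
  qed
  have f_mult: "f (r \<otimes>\<^bsub>R\<^esub> r') = (f r \<otimes>\<^bsub>R\<^esub> r') \<oplus>\<^bsub>R\<^esub> (r \<otimes>\<^bsub>R\<^esub> f r')"
    if r: "r \<in> carrier R" "r' \<in> carrier R" for r r'
  proof -
    have act: "f (r \<otimes>\<^bsub>R\<^esub> r') \<odot> m = ((f r \<otimes>\<^bsub>R\<^esub> r') \<oplus>\<^bsub>R\<^esub> (r \<otimes>\<^bsub>R\<^esub> f r')) \<odot> m"
      if m: "m \<in> carrier M" for m
    proof -
      have "(f (r \<otimes>\<^bsub>R\<^esub> r') \<odot> m) \<oplus> ((r \<otimes>\<^bsub>R\<^esub> r') \<odot> h m) = h ((r \<otimes>\<^bsub>R\<^esub> r') \<odot> m)"
        using r m by (simp only: left R.m_closed)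
      also have "\<dots> = h (r \<odot> (r' \<odot> m))"
        using r m by (simp only: smult_assoc)
      also have "\<dots> = (((f r \<otimes>\<^bsub>R\<^esub> r') \<oplus>\<^bsub>R\<^esub> (r \<otimes>\<^bsub>R\<^esub> f r')) \<odot> m) \<oplus> ((r \<otimes>\<^bsub>R\<^esub> r') \<odot> h m)"
        using r m by (simp add: left bimodule_simps f h M.a_assoc)
      finally show ?thesis using r m by (simp add: f h smult_closed)
    qed
    let ?u = "f (r \<otimes>\<^bsub>R\<^esub> r')" and ?v = "(f r \<otimes>\<^bsub>R\<^esub> r') \<oplus>\<^bsub>R\<^esub> (r \<otimes>\<^bsub>R\<^esub> f r')"
    have uv: "?u \<in> carrier R" "?v \<in> carrier R" using r f by auto
    have "(?u \<ominus>\<^bsub>R\<^esub> ?v) \<odot> m = \<zero>" if m: "m \<in> carrier M" for m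
    proof -
      have "(?u \<ominus>\<^bsub>R\<^esub> ?v) \<odot> m = (?v \<odot> m) \<oplus> ((\<ominus>\<^bsub>R\<^esub> ?v) \<odot> m)"
        using uv m by (simp only: R.minus_eq smult_l_distr R.a_inv_closed act)
      also have "\<dots> = (?v \<oplus>\<^bsub>R\<^esub> (\<ominus>\<^bsub>R\<^esub> ?v)) \<odot> m"
        using uv m by (simp only: smult_l_distr R.a_inv_closed)
      also have "\<dots> = \<zero>" using uv m by (simp only: R.r_neg zero_smult)
      finally show ?thesis .
    qed
    then have "?u \<ominus>\<^bsub>R\<^esub> ?v = \<zero>\<^bsub>R\<^esub>"
      using \<open>faithful_left R M\<close> uv by (simp add: faithful_left_def)
    then show ?thesis using uv by simp
  qed
  have g_mult: "g (s \<otimes>\<^bsub>S\<^esub> s') = (g s \<otimes>\<^bsub>S\<^esub> s') \<oplus>\<^bsub>S\<^esub> (s \<otimes>\<^bsub>S\<^esub> g s')"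
    if s: "s \<in> carrier S" "s' \<in> carrier S" for s s'
  proof -
    have act: "m \<odot>\<^sub>r g (s \<otimes>\<^bsub>S\<^esub> s') = m \<odot>\<^sub>r ((g s \<otimes>\<^bsub>S\<^esub> s') \<oplus>\<^bsub>S\<^esub> (s \<otimes>\<^bsub>S\<^esub> g s'))"
      if m: "m \<in> carrier M" for m
    proof -
      have "(m \<odot>\<^sub>r g (s \<otimes>\<^bsub>S\<^esub> s')) \<oplus> (h m \<odot>\<^sub>r (s \<otimes>\<^bsub>S\<^esub> s')) = h (m \<odot>\<^sub>r (s \<otimes>\<^bsub>S\<^esub> s'))"
        using s m by (simp only: right S.m_closed)
      also have "\<dots> = h ((m \<odot>\<^sub>r s) \<odot>\<^sub>r s')"
        using s m by (simp only: rsmult_assoc)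
      also have "\<dots> = (m \<odot>\<^sub>r ((g s \<otimes>\<^bsub>S\<^esub> s') \<oplus>\<^bsub>S\<^esub> (s \<otimes>\<^bsub>S\<^esub> g s'))) \<oplus> (h m \<odot>\<^sub>r (s \<otimes>\<^bsub>S\<^esub> s'))"
        using s m by (simp add: right bimodule_simps g h M.a_ac)
      finally show ?thesis using s m by (simp add: g h rsmult_closed)
    qed
    let ?u = "g (s \<otimes>\<^bsub>S\<^esub> s')" and ?v = "(g s \<otimes>\<^bsub>S\<^esub> s') \<oplus>\<^bsub>S\<^esub> (s \<otimes>\<^bsub>S\<^esub> g s')"
    have uv: "?u \<in> carrier S" "?v \<in> carrier S" using s g by auto
    have "m \<odot>\<^sub>r (?u \<ominus>\<^bsub>S\<^esub> ?v) = \<zero>" if m: "m \<in> carrier M" for m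
    proof -
      have "m \<odot>\<^sub>r (?u \<ominus>\<^bsub>S\<^esub> ?v) = (m \<odot>\<^sub>r ?v) \<oplus> (m \<odot>\<^sub>r (\<ominus>\<^bsub>S\<^esub> ?v))"
        using uv m by (simp only: S.minus_eq rsmult_r_distr S.a_inv_closed act)
      also have "\<dots> = m \<odot>\<^sub>r (?v \<oplus>\<^bsub>S\<^esub> (\<ominus>\<^bsub>S\<^esub> ?v))"
        using uv m by (simp only: rsmult_r_distr S.a_inv_closed)
      also have "\<dots> = \<zero>" using uv m by (simp only: S.r_neg rsmult_zero)
      finally show ?thesis .
    qed
    then have "?u \<ominus>\<^bsub>S\<^esub> ?v = \<zero>\<^bsub>S\<^esub>"
      using \<open>faithful_right S M\<close> uv by (simp add: faithful_right_def)
    then show ?thesis using uv by simp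
  qed
  have "d (x \<otimes>\<^bsub>T\<^esub> y) = (d x \<otimes>\<^bsub>T\<^esub> y) \<oplus>\<^bsub>T\<^esub> (x \<otimes>\<^bsub>T\<^esub> d y)"
    if "x \<in> carrier T" "y \<in> carrier T" for x y
    using that
    by (cases x; cases y)
      (simp add: triangular_simps d f g h f_mult g_mult h_add left right bimodule_simps M.a_ac)
  with additive show ?thesis by (simp add: derivation_def)
qed

theorem degree_zero_is_derivation:
  assumes "two_torsion_free R" "two_torsion_free S"
    and "faithful_left R M" "faithful_right S M"
    and d: "jordan_superderivation_deg T G 0 d"
  shows "derivation T d"
proof -
  have additive: "d \<in> hom (add_monoid T) (add_monoid T)"
    using d by (simp add: jordan_superderivation_deg_def)
  have identity: "d (jordan_superproduct T i j x y) =
      jordan_superproduct T i j (d x) y \<oplus>\<^bsub>T\<^esub> jordan_superproduct T i j x (d y)"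
    if "x \<in> G i" "y \<in> G j" for i j x y
    using d that by (simp add: jordan_superderivation_deg_def super_sign_def)
  have maps: "d x \<in> G i" if "x \<in> G i" for x i
  proof -
    have "d x \<in> G (0 + i)"
      using d that unfolding jordan_superderivation_deg_def by blast
    then show ?thesis by (simp only: add_0_left)
  qed
  have even: "\<exists>a b. d (r, \<zero>, s) = (a, \<zero>, b) \<and> a \<in> carrier R \<and> b \<in> carrier S"
    if "r \<in> carrier R" "s \<in> carrier S" for r s
    using maps[of "(r, \<zero>, s)" 0] that by (cases "d (r, \<zero>, s)") (simp add: grading_simps)
  have odd: "\<exists>m'. d (\<zero>\<^bsub>R\<^esub>, m, \<zero>\<^bsub>S\<^esub>) = (\<zero>\<^bsub>R\<^esub>, m', \<zero>\<^bsub>S\<^esub>) \<and> m' \<in> carrier M"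
    if "m \<in> carrier M" for m
    using maps[of "(\<zero>\<^bsub>R\<^esub>, m, \<zero>\<^bsub>S\<^esub>)" 1] that
    by (cases "d (\<zero>\<^bsub>R\<^esub>, m, \<zero>\<^bsub>S\<^esub>)") (simp add: grading_simps)
  have d_add: "d (x \<oplus>\<^bsub>T\<^esub> y) = d x \<oplus>\<^bsub>T\<^esub> d y" if "x \<in> carrier T" "y \<in> carrier T" for x y
    using additive that by (simp add: hom_def)

  let ?e = "(\<one>\<^bsub>R\<^esub>, \<zero>, \<zero>\<^bsub>S\<^esub>)" and ?e' = "(\<zero>\<^bsub>R\<^esub>, \<zero>, \<one>\<^bsub>S\<^esub>)"
  have de: "d ?e = (\<zero>\<^bsub>R\<^esub>, \<zero>, \<zero>\<^bsub>S\<^esub>)"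
  proof -
    obtain a b where ab: "d ?e = (a, \<zero>, b)" "a \<in> carrier R" "b \<in> carrier S"
      using even[of "\<one>\<^bsub>R\<^esub>" "\<zero>\<^bsub>S\<^esub>"] by auto
    have "d ?e \<oplus>\<^bsub>T\<^esub> d ?e = d (jordan_superproduct T 0 0 ?e ?e)"
      using d_add[of ?e ?e] by (simp add: superproduct_even_even triangular_simps)
    also have "\<dots> = jordan_superproduct T 0 0 (d ?e) ?e \<oplus>\<^bsub>T\<^esub> jordan_superproduct T 0 0 ?e (d ?e)"
      by (rule identity) (auto simp: grading_simps)
    finally have "a \<oplus>\<^bsub>R\<^esub> a = (a \<oplus>\<^bsub>R\<^esub> a) \<oplus>\<^bsub>R\<^esub> (a \<oplus>\<^bsub>R\<^esub> a)" and "b \<oplus>\<^bsub>S\<^esub> b = \<zero>\<^bsub>S\<^esub>"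
      using ab by (auto simp: superproduct_even_even triangular_simps)
    then have "a = \<zero>\<^bsub>R\<^esub>" and "b = \<zero>\<^bsub>S\<^esub>"
      using ab assms(1,2) by (blast intro: R.two_torsion_free_cancel two_torsion_freeD)+
    then show ?thesis using ab by simp
  qed
  have de': "d ?e' = (\<zero>\<^bsub>R\<^esub>, \<zero>, \<zero>\<^bsub>S\<^esub>)"
  proof -
    obtain a b where ab: "d ?e' = (a, \<zero>, b)" "a \<in> carrier R" "b \<in> carrier S"
      using even[of "\<zero>\<^bsub>R\<^esub>" "\<one>\<^bsub>S\<^esub>"] by auto
    have "d ?e' \<oplus>\<^bsub>T\<^esub> d ?e' = d (jordan_superproduct T 0 0 ?e' ?e')"
      using d_add[of ?e' ?e'] by (simp add: superproduct_even_even triangular_simps)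
    also have "\<dots> = jordan_superproduct T 0 0 (d ?e') ?e' \<oplus>\<^bsub>T\<^esub> jordan_superproduct T 0 0 ?e' (d ?e')"
      by (rule identity) (auto simp: grading_simps)
    finally have "a \<oplus>\<^bsub>R\<^esub> a = \<zero>\<^bsub>R\<^esub>" and "b \<oplus>\<^bsub>S\<^esub> b = (b \<oplus>\<^bsub>S\<^esub> b) \<oplus>\<^bsub>S\<^esub> (b \<oplus>\<^bsub>S\<^esub> b)"
      using ab by (auto simp: superproduct_even_even triangular_simps)
    then have "a = \<zero>\<^bsub>R\<^esub>" and "b = \<zero>\<^bsub>S\<^esub>"
      using ab assms(1,2) by (blast intro: S.two_torsion_free_cancel two_torsion_freeD)+
    then show ?thesis using ab by simp
  qed

  define f where "f r = fst (d (r, \<zero>, \<zero>\<^bsub>S\<^esub>))" for r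
  define h where "h m = fst (snd (d (\<zero>\<^bsub>R\<^esub>, m, \<zero>\<^bsub>S\<^esub>)))" for m
  define g where "g s = snd (snd (d (\<zero>\<^bsub>R\<^esub>, \<zero>, s)))" for s
  have f: "f r \<in> carrier R" "d (r, \<zero>, \<zero>\<^bsub>S\<^esub>) = (f r, \<zero>, \<zero>\<^bsub>S\<^esub>)" if r: "r \<in> carrier R" for r
  proof -
    let ?x = "(r, \<zero>, \<zero>\<^bsub>S\<^esub>)"
    obtain a b where ab: "d ?x = (a, \<zero>, b)" "a \<in> carrier R" "b \<in> carrier S"
      using even[of r "\<zero>\<^bsub>S\<^esub>"] r by auto
    have "d ?x \<oplus>\<^bsub>T\<^esub> d ?x = d (jordan_superproduct T 0 0 ?e ?x)"
      using d_add[of ?x ?x] r by (simp add: superproduct_even_even triangular_simps)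
    also have "\<dots> = jordan_superproduct T 0 0 (d ?e) ?x \<oplus>\<^bsub>T\<^esub> jordan_superproduct T 0 0 ?e (d ?x)"
      by (rule identity) (use r in \<open>auto simp: grading_simps\<close>)
    finally have "b \<oplus>\<^bsub>S\<^esub> b = \<zero>\<^bsub>S\<^esub>"
      using ab r by (auto simp: de superproduct_even_even triangular_simps)
    then have "b = \<zero>\<^bsub>S\<^esub>"
      using ab assms(2) by (blast intro: two_torsion_freeD)
    then show "f r \<in> carrier R" "d ?x = (f r, \<zero>, \<zero>\<^bsub>S\<^esub>)"
      using ab by (simp_all add: f_def)
  qed
  have g: "g s \<in> carrier S" "d (\<zero>\<^bsub>R\<^esub>, \<zero>, s) = (\<zero>\<^bsub>R\<^esub>, \<zero>, g s)" if s: "s \<in> carrier S" for s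
  proof -
    let ?x = "(\<zero>\<^bsub>R\<^esub>, \<zero>, s)"
    obtain a b where ab: "d ?x = (a, \<zero>, b)" "a \<in> carrier R" "b \<in> carrier S"
      using even[of "\<zero>\<^bsub>R\<^esub>" s] s by auto
    have "d ?x \<oplus>\<^bsub>T\<^esub> d ?x = d (jordan_superproduct T 0 0 ?e' ?x)"
      using d_add[of ?x ?x] s by (simp add: superproduct_even_even triangular_simps)
    also have "\<dots> = jordan_superproduct T 0 0 (d ?e') ?x \<oplus>\<^bsub>T\<^esub> jordan_superproduct T 0 0 ?e' (d ?x)"
      by (rule identity) (use s in \<open>auto simp: grading_simps\<close>)
    finally have "a \<oplus>\<^bsub>R\<^esub> a = \<zero>\<^bsub>R\<^esub>"
      using ab s by (auto simp: de' superproduct_even_even triangular_simps)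
    then have "a = \<zero>\<^bsub>R\<^esub>"
      using ab assms(1) by (blast intro: two_torsion_freeD)
    then show "g s \<in> carrier S" "d ?x = (\<zero>\<^bsub>R\<^esub>, \<zero>, g s)"
      using ab by (simp_all add: g_def)
  qed
  have h: "h m \<in> carrier M" "d (\<zero>\<^bsub>R\<^esub>, m, \<zero>\<^bsub>S\<^esub>) = (\<zero>\<^bsub>R\<^esub>, h m, \<zero>\<^bsub>S\<^esub>)" if "m \<in> carrier M" for m
    using odd[OF that] by (auto simp: h_def)
  show ?thesis
  proof (rule blockwise_derivation[OF assms(3,4) additive f(1) h(1) g(1)])
    fix r m s assume "r \<in> carrier R" "m \<in> carrier M" "s \<in> carrier S"
    then show "d (r, m, s) = (f r, h m, g s)"
      using triangular_decomposition[OF additive, of r m s] f h g by (simp add: triangular_simps)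
  next
    fix r m assume rm: "r \<in> carrier R" "m \<in> carrier M"
    then show "h (r \<odot> m) = (f r \<odot> m) \<oplus> (r \<odot> h m)"
      using identity[of "(r, \<zero>, \<zero>\<^bsub>S\<^esub>)" 0 "(\<zero>\<^bsub>R\<^esub>, m, \<zero>\<^bsub>S\<^esub>)" 1] f[of r] h[of m] h[of "r \<odot> m"]
      by (simp add: grading_simps superproduct_even_odd triangular_simps bimodule_simps)
  next
    fix m s assume ms: "m \<in> carrier M" "s \<in> carrier S"
    then show "h (m \<odot>\<^sub>r s) = (m \<odot>\<^sub>r g s) \<oplus> (h m \<odot>\<^sub>r s)"
      using identity[of "(\<zero>\<^bsub>R\<^esub>, \<zero>, s)" 0 "(\<zero>\<^bsub>R\<^esub>, m, \<zero>\<^bsub>S\<^esub>)" 1] g[of s] h[of m] h[of "m \<odot>\<^sub>r s"]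
      by (simp add: grading_simps superproduct_even_odd triangular_simps bimodule_simps)
  qed
qed

section \<open>Superderivations of degree 1\<close>

text \<open>
  The superproduct of an even with an odd element carries no sign, so for \<open>x\<close> in the \<open>R\<close>-corner
  \<open>d(e)\<close> enters the identity for \<open>e \<circ> x = 2x\<close> as \<open>d(e) x + x d(e)\<close>, of which only \<open>x d(e)\<close>
  survives. On the \<open>S\<close>-corner, where \<open>e'\<close> takes the place of \<open>e\<close>, it is \<open>d(e') x\<close> that survives,
  and the minus sign comes from \<open>d(e') = - d(e)\<close>.
\<close>

theorem degree_one_is_inner:
  assumes d: "jordan_superderivation_deg T G 1 d" and x: "x \<in> carrier T"
  shows "d x = x \<otimes>\<^bsub>T\<^esub> d (\<one>\<^bsub>R\<^esub>, \<zero>, \<zero>\<^bsub>S\<^esub>) \<ominus>\<^bsub>T\<^esub> d (\<one>\<^bsub>R\<^esub>, \<zero>, \<zero>\<^bsub>S\<^esub>) \<otimes>\<^bsub>T\<^esub> x"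
proof -
  interpret T: ring T by (rule triangular_ring_is_ring)
  have additive: "d \<in> hom (add_monoid T) (add_monoid T)"
    using d by (simp add: jordan_superderivation_deg_def)
  have identity: "d (jordan_superproduct T 0 j x y) =
      jordan_superproduct T 1 j (d x) y \<oplus>\<^bsub>T\<^esub> jordan_superproduct T 0 (1 + j) x (d y)"
    if "x \<in> G 0" "y \<in> G j" for j x y
  proof -
    have "d (jordan_superproduct T 0 j x y) = jordan_superproduct T (1 + 0) j (d x) y \<oplus>\<^bsub>T\<^esub>
        super_sign T (1 * 0) (jordan_superproduct T 0 (1 + j) x (d y))"
      using d that unfolding jordan_superderivation_deg_def by blast
    then show ?thesis by (simp add: super_sign_def)
  qed
  have maps: "d x \<in> G (1 + i)" if "x \<in> G i" for x i
    using d that unfolding jordan_superderivation_deg_def by blast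
  have even: "\<exists>m. d (r, \<zero>, s) = (\<zero>\<^bsub>R\<^esub>, m, \<zero>\<^bsub>S\<^esub>) \<and> m \<in> carrier M"
    if "r \<in> carrier R" "s \<in> carrier S" for r s
    using maps[of "(r, \<zero>, s)" 0] that by (cases "d (r, \<zero>, s)") (simp add: grading_simps)
  have odd: "\<exists>a b. d (\<zero>\<^bsub>R\<^esub>, m, \<zero>\<^bsub>S\<^esub>) = (a, \<zero>, b) \<and> a \<in> carrier R \<and> b \<in> carrier S"
    if "m \<in> carrier M" for m
    using maps[of "(\<zero>\<^bsub>R\<^esub>, m, \<zero>\<^bsub>S\<^esub>)" 1] that
    by (cases "d (\<zero>\<^bsub>R\<^esub>, m, \<zero>\<^bsub>S\<^esub>)") (simp add: grading_simps)
  have d_add: "d (x \<oplus>\<^bsub>T\<^esub> y) = d x \<oplus>\<^bsub>T\<^esub> d y" if "x \<in> carrier T" "y \<in> carrier T" for x y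
    using additive that by (simp add: hom_def)

  let ?e = "(\<one>\<^bsub>R\<^esub>, \<zero>, \<zero>\<^bsub>S\<^esub>)" and ?e' = "(\<zero>\<^bsub>R\<^esub>, \<zero>, \<one>\<^bsub>S\<^esub>)"
  obtain a where a: "d ?e = (\<zero>\<^bsub>R\<^esub>, a, \<zero>\<^bsub>S\<^esub>)" "a \<in> carrier M"
    using even[of "\<one>\<^bsub>R\<^esub>" "\<zero>\<^bsub>S\<^esub>"] by auto
  have a': "d ?e' = (\<zero>\<^bsub>R\<^esub>, \<ominus> a, \<zero>\<^bsub>S\<^esub>)"
  proof -
    obtain a' where a': "d ?e' = (\<zero>\<^bsub>R\<^esub>, a', \<zero>\<^bsub>S\<^esub>)" "a' \<in> carrier M"
      using even[of "\<zero>\<^bsub>R\<^esub>" "\<one>\<^bsub>S\<^esub>"] by auto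
    \<comment> \<open>Here \<open>e \<circ> e' = 0\<close> gives \<open>a \<oplus> a' = 0\<close>.\<close>
    have "a' \<oplus> a = \<zero>"
      using identity[of ?e ?e' 0] a a' additive_zero[OF additive]
      by (simp add: grading_simps superproduct_even_even superproduct_odd_even
          superproduct_even_odd triangular_simps bimodule_simps M.a_comm)
    then show ?thesis using a a' by (simp add: M.minus_equality)
  qed
  have R_corner: "d (r, \<zero>, \<zero>\<^bsub>S\<^esub>) = (\<zero>\<^bsub>R\<^esub>, r \<odot> a, \<zero>\<^bsub>S\<^esub>)" if r: "r \<in> carrier R" for r
  proof -
    let ?x = "(r, \<zero>, \<zero>\<^bsub>S\<^esub>)"
    obtain m where m: "d ?x = (\<zero>\<^bsub>R\<^esub>, m, \<zero>\<^bsub>S\<^esub>)" "m \<in> carrier M"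
      using even[of r "\<zero>\<^bsub>S\<^esub>"] r by auto
    have "d ?x \<oplus>\<^bsub>T\<^esub> d ?x = d (jordan_superproduct T 0 0 ?e ?x)"
      using d_add[of ?x ?x] r by (simp add: superproduct_even_even triangular_simps)
    also have "\<dots> = jordan_superproduct T 1 0 (d ?e) ?x \<oplus>\<^bsub>T\<^esub> jordan_superproduct T 0 1 ?e (d ?x)"
      using identity[of ?e ?x 0] r by (simp add: grading_simps)
    finally have "m \<oplus> m = (r \<odot> a) \<oplus> m"
      using a m r by (simp add: superproduct_odd_even superproduct_even_odd triangular_simps bimodule_simps)
    then show ?thesis using a m r by (simp add: smult_closed)
  qed
  have S_corner: "d (\<zero>\<^bsub>R\<^esub>, \<zero>, s) = (\<zero>\<^bsub>R\<^esub>, (\<ominus> a) \<odot>\<^sub>r s, \<zero>\<^bsub>S\<^esub>)" if s: "s \<in> carrier S" for s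
  proof -
    let ?x = "(\<zero>\<^bsub>R\<^esub>, \<zero>, s)"
    obtain m where m: "d ?x = (\<zero>\<^bsub>R\<^esub>, m, \<zero>\<^bsub>S\<^esub>)" "m \<in> carrier M"
      using even[of "\<zero>\<^bsub>R\<^esub>" s] s by auto
    have "d ?x \<oplus>\<^bsub>T\<^esub> d ?x = d (jordan_superproduct T 0 0 ?e' ?x)"
      using d_add[of ?x ?x] s by (simp add: superproduct_even_even triangular_simps)
    also have "\<dots> = jordan_superproduct T 1 0 (d ?e') ?x \<oplus>\<^bsub>T\<^esub> jordan_superproduct T 0 1 ?e' (d ?x)"
      using identity[of ?e' ?x 0] s by (simp add: grading_simps)
    finally have "m \<oplus> m = ((\<ominus> a) \<odot>\<^sub>r s) \<oplus> m"
      using a a' m s by (simp add: superproduct_odd_even superproduct_even_odd triangular_simps bimodule_simps)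
    then show ?thesis using a m s by (simp add: rsmult_closed)
  qed
  have M_corner: "d (\<zero>\<^bsub>R\<^esub>, m, \<zero>\<^bsub>S\<^esub>) = (\<zero>\<^bsub>R\<^esub>, \<zero>, \<zero>\<^bsub>S\<^esub>)" if m: "m \<in> carrier M" for m
  proof -
    let ?x = "(\<zero>\<^bsub>R\<^esub>, m, \<zero>\<^bsub>S\<^esub>)"
    obtain p q where pq: "d ?x = (p, \<zero>, q)" "p \<in> carrier R" "q \<in> carrier S"
      using odd[OF m] by auto
    \<comment> \<open>The superproduct of the odd elements \<open>d(e)\<close> and \<open>x\<close> vanishes, so only \<open>e \<circ> d(x)\<close> is left.\<close>
    have "q = \<zero>\<^bsub>S\<^esub>"
      using identity[of ?e ?x 1] a pq m
      by (simp add: grading_simps superproduct_even_even superproduct_even_odd superproduct_odd_odd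
          triangular_simps bimodule_simps)
    moreover have "p = \<zero>\<^bsub>R\<^esub>"
      using identity[of ?e' ?x 1] a a' pq m
      by (simp add: grading_simps superproduct_even_even superproduct_even_odd superproduct_odd_odd
          triangular_simps bimodule_simps)
    ultimately show ?thesis using pq by simp
  qed
  obtain r m s where rms: "x = (r, m, s)" "r \<in> carrier R" "m \<in> carrier M" "s \<in> carrier S"
    using x by (cases x) (auto simp: triangular_simps)
  have "(\<ominus> a) \<odot>\<^sub>r s = \<ominus> (a \<odot>\<^sub>r s)"
    using a rms by (metis M.a_inv_closed M.l_neg M.minus_equality rsmult_closed rsmult_l_distr zero_rsmult)
  moreover have "d x = (\<zero>\<^bsub>R\<^esub>, (r \<odot> a) \<oplus> ((\<ominus> a) \<odot>\<^sub>r s), \<zero>\<^bsub>S\<^esub>)"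
    using triangular_decomposition[OF additive rms(2-)] rms a
    by (simp add: R_corner S_corner M_corner triangular_simps bimodule_simps)
  ultimately show ?thesis
    using a rms by (simp add: T.minus_eq triangular_simps triangular_minus bimodule_simps)
qed

end

section \<open>Jordan superderivations are derivations\<close>

theorem corollary2p4:
  fixes R :: "('r, 'a) ring_scheme"
    and S :: "('s, 'b) ring_scheme"
    and M :: "('r, 's, 'm, 'c) bimodule_scheme"
    and d :: "'r \<times> 'm \<times> 's \<Rightarrow> 'r \<times> 'm \<times> 's"
  assumes "ring R" and "ring S"
    and "two_torsion_free R" and "two_torsion_free S"
    and "unitary_bimodule R S M"
    and "faithful_left R M" and "faithful_right S M"
    and "jordan_superderivation (triangular_ring R M S) (triangular_grading R M S) d"
  shows "derivation (triangular_ring R M S) d"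
proof -
  interpret unitary_bimodule R S M by fact
  interpret T: ring T by (rule triangular_ring_is_ring)
  obtain d0 d1 where d0: "jordan_superderivation_deg T G 0 d0"
    and d1: "jordan_superderivation_deg T G 1 d1"
    and d: "\<And>x. x \<in> carrier T \<Longrightarrow> d x = d0 x \<oplus>\<^bsub>T\<^esub> d1 x"
    using assms(8) unfolding jordan_superderivation_def by blast
  have "(\<one>\<^bsub>R\<^esub>, \<zero>\<^bsub>M\<^esub>, \<zero>\<^bsub>S\<^esub>) \<in> carrier T"
    by (simp add: triangular_simps)
  then have "d1 (\<one>\<^bsub>R\<^esub>, \<zero>\<^bsub>M\<^esub>, \<zero>\<^bsub>S\<^esub>) \<in> carrier T"
    using d1 by (auto simp: jordan_superderivation_deg_def hom_def)
  then have "derivation T d1"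
    using degree_one_is_inner[OF d1] by (rule derivation_inner[OF T.ring_axioms])
  moreover have "derivation T d0"
    using assms(3,4,6,7) d0 by (rule degree_zero_is_derivation)
  ultimately show ?thesis
    by (intro derivation_add[OF T.ring_axioms _ _ d])
qed

end
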